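(* Let $q\ge 2$ be a prime power. For every integer $n\geq 1$ there exists a family $\lbrace L_m\rbrace_{m\ge 1}$ of non-abelian finite-dimensional Lie algebras over the finite field $\mathbb{F}_q$ with asymptotic commutativity degree $\frac{1}{q^{n}}$, i.e. such that $|L_m|\to\infty$ as $m\to\infty$ and $\lim_{m\to\infty} d(L_m)=\frac{1}{q^n}$.
   Context: For a finite-dimensional Lie algebra $L$ over $\mathbb{F}_q$, the commutativity degree is $d(L)=\dfrac{|\{(x,y)\in L\times L : [x,y]=0\}|}{|L|^2}$. If $\lbrace L_m\rbrace_{m\ge1}$ is a family of Lie algebras with $|L_m|\to\infty$ as $m\to\infty$, then $\lim_{m\to\infty} d(L_m)$, if it exists, is called the asymptotic commutativity degree of the family. *)

theory Defs
  imports
    "HOL-Number_Theory.Prime_Powers"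
    "Jordan_Normal_Form.Missing_VectorSpace"
    Complex_Main
begin

text \<open>
  As for \<open>module\<close>, the record inherits the ring fields \<open>mult\<close> and \<open>one\<close>; these carry no
  information. The Lie product is the new field \<open>bracket\<close>.
\<close>

record ('k, 'v) lie_algebra = "('k, 'v) module" +
  bracket :: "'v \<Rightarrow> 'v \<Rightarrow> 'v"

locale lie_algebra = vectorspace K L
  for K :: "('k, 'r) ring_scheme" and L :: "('k, 'v, 'm) lie_algebra_scheme" +
  assumes bracket_closed:
      "\<lbrakk>x \<in> carrier L; y \<in> carrier L\<rbrakk> \<Longrightarrow> bracket L x y \<in> carrier L"
    and bracket_add_left:
      "\<lbrakk>x \<in> carrier L; y \<in> carrier L; z \<in> carrier L\<rbrakk>
        \<Longrightarrow> bracket L (x \<oplus>\<^bsub>L\<^esub> y) z = bracket L x z \<oplus>\<^bsub>L\<^esub> bracket L y z"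
    and bracket_add_right:
      "\<lbrakk>x \<in> carrier L; y \<in> carrier L; z \<in> carrier L\<rbrakk>
        \<Longrightarrow> bracket L x (y \<oplus>\<^bsub>L\<^esub> z) = bracket L x y \<oplus>\<^bsub>L\<^esub> bracket L x z"
    and bracket_smult_left:
      "\<lbrakk>a \<in> carrier K; x \<in> carrier L; y \<in> carrier L\<rbrakk>
        \<Longrightarrow> bracket L (a \<odot>\<^bsub>L\<^esub> x) y = a \<odot>\<^bsub>L\<^esub> bracket L x y"
    and bracket_smult_right:
      "\<lbrakk>a \<in> carrier K; x \<in> carrier L; y \<in> carrier L\<rbrakk>
        \<Longrightarrow> bracket L x (a \<odot>\<^bsub>L\<^esub> y) = a \<odot>\<^bsub>L\<^esub> bracket L x y"
    and bracket_self:
      "x \<in> carrier L \<Longrightarrow> bracket L x x = \<zero>\<^bsub>L\<^esub>"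
    and jacobi:
      "\<lbrakk>x \<in> carrier L; y \<in> carrier L; z \<in> carrier L\<rbrakk>
        \<Longrightarrow> bracket L x (bracket L y z) \<oplus>\<^bsub>L\<^esub> bracket L y (bracket L z x)
              \<oplus>\<^bsub>L\<^esub> bracket L z (bracket L x y) = \<zero>\<^bsub>L\<^esub>"

definition abelian_lie :: "('k, 'v, 'm) lie_algebra_scheme \<Rightarrow> bool" where
  "abelian_lie L \<longleftrightarrow> (\<forall>x\<in>carrier L. \<forall>y\<in>carrier L. bracket L x y = \<zero>\<^bsub>L\<^esub>)"

text \<open>Only meaningful when the carrier is finite, since \<open>card\<close> of an infinite set is \<open>0\<close>.\<close>

definition commutativity_degree :: "('k, 'v, 'm) lie_algebra_scheme \<Rightarrow> real" where
  "commutativity_degree L =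
     real (card {(x, y). x \<in> carrier L \<and> y \<in> carrier L \<and> bracket L x y = \<zero>\<^bsub>L\<^esub>})
       / (real (card (carrier L)))\<^sup>2"

text \<open>Families are indexed by \<open>m \<ge> 1\<close>; the value at \<open>0\<close> does not affect either limit.\<close>

definition has_asymptotic_commutativity_degree ::
    "(nat \<Rightarrow> ('k, 'v, 'm) lie_algebra_scheme) \<Rightarrow> real \<Rightarrow> bool" where
  "has_asymptotic_commutativity_degree L c \<longleftrightarrow>
     filterlim (\<lambda>m. card (carrier (L m))) at_top sequentially \<and>
     (\<lambda>m. commutativity_degree (L m)) \<longlonglongrightarrow> c"

end

theory Submission
  imports Defs
begin

text \<open>
  Let \<open>K\<close> be the field with \<open>q\<close> elements. In a finite Lie algebra \<open>L\<close>, rank-nullity for the additive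
  map \<open>[x, -]\<close> gives \<open>|C(x)| = |L| / |[x, L]|\<close>, so \<open>d(L)\<close> is the average over \<open>x\<close> of
  \<open>1 / |[x, L]|\<close>. Hence it suffices to find arbitrarily large Lie algebras in which \<open>[x, L]\<close> always
  has at most \<open>q^n\<close> elements, and exactly \<open>q^n\<close> unless \<open>x\<close> belongs to a subset whose proportion
  tends to \<open>0\<close> (\<open>commutativity_degree_bounds\<close>).

  Such a Lie algebra is \<open>L_m = K^m \<oplus> Hom(K^m, K^n) \<oplus> K^n\<close> with
  \<open>[(v, \<phi>, z), (w, \<psi>, u)] = (0, 0, \<psi>(v) - \<phi>(w))\<close>. All brackets lie in the last summand, which
  is central; so the Jacobi identity holds because each of its terms vanishes, and \<open>[x, L]\<close> has at
  most \<open>q^n\<close> elements. If \<open>x = (v, \<phi>, z)\<close> with \<open>v \<noteq> 0\<close>, then \<open>\<psi>(v)\<close> takes every value in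
  \<open>K^n\<close> as \<open>\<psi>\<close> varies, so \<open>[x, L]\<close> is the whole last summand (\<open>ad_image_eq\<close>). The exceptional
  elements, those with \<open>v = 0\<close>, have proportion \<open>q^(-m)\<close> (\<open>card_zero_vector_block\<close>). Therefore
  \<open>1/q^n \<le> d(L_m) \<le> 1/q^n + 1/q^m\<close>, and \<open>d(L_m)\<close> tends to \<open>1/q^n\<close>.
\<close>

section \<open>Commutativity degree and ranks of adjoint maps\<close>

lemma (in group_hom) card_kernel_times_card_image:
  assumes "finite (carrier G)"
  shows "card (kernel G H h) * card (h ` carrier G) = order G"
proof -
  let ?I = "H\<lparr>carrier := h ` carrier G\<rparr>"
  have "group ?I"
    using img_is_subgroup by (rule H.subgroup_imp_group)
  then interpret img: group_hom G ?I h
    by (intro group_hom.intro group_hom_axioms.intro is_group) (auto simp: hom_def)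
  have "(\<lambda>X. the_elem (h ` X)) \<in> iso (G Mod kernel G ?I h) ?I"
    by (rule img.FactGroup_iso_set) simp
  then have "card (rcosets kernel G ?I h) = card (h ` carrier G)"
    by (auto simp: iso_def FactGroup_def dest: bij_betw_same_card)
  moreover have "kernel G ?I h = kernel G H h"
    by (simp add: kernel_def)
  ultimately show ?thesis
    using G.lagrange[OF subgroup_kernel] by (simp add: mult.commute)
qed

context lie_algebra
begin

abbreviation centralizer :: "'v \<Rightarrow> 'v set" where
  "centralizer x \<equiv> {y \<in> carrier L. bracket L x y = \<zero>\<^bsub>L\<^esub>}"

lemma card_centralizer_times_card_ad_image:
  assumes "finite (carrier L)" "x \<in> carrier L"
  shows "card (centralizer x) * card (bracket L x ` carrier L) = card (carrier L)"
proof -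
  have "group (add_monoid L)"
    by (rule a_group)
  then interpret ad: group_hom "add_monoid L" "add_monoid L" "bracket L x"
    using assms(2)
    by (simp add: group_hom_def group_hom_axioms_def hom_def bracket_closed bracket_add_right)
  show ?thesis
    using ad.card_kernel_times_card_image assms(1) by (simp add: kernel_def order_def)
qed

text \<open>
  Summing \<open>|C(x)| = |L| / |[x, L]|\<close> over \<open>x\<close> counts the commuting pairs. Each term is at least
  \<open>|L| / r\<close>, with equality off \<open>B\<close>; on \<open>B\<close> the trivial bound \<open>|C(x)| \<le> |L|\<close> costs no more than
  the proportion of \<open>B\<close> in \<open>L\<close>.
\<close>

lemma commutativity_degree_bounds:
  assumes fin: "finite (carrier L)" and r: "r > 0" and B: "B \<subseteq> carrier L"
    and le: "\<And>x. x \<in> carrier L \<Longrightarrow> card (bracket L x ` carrier L) \<le> r"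
    and eq: "\<And>x. x \<in> carrier L - B \<Longrightarrow> card (bracket L x ` carrier L) = r"
  shows "1 / real r \<le> commutativity_degree L"
    and "commutativity_degree L \<le> 1 / real r + real (card B) / real (card (carrier L))"
proof -
  let ?N = "real (card (carrier L))"
  have ne: "carrier L \<noteq> {}" by auto
  then have N: "?N > 0" using fin by (simp add: card_gt_0_iff)
  have "{(x, y). x \<in> carrier L \<and> y \<in> carrier L \<and> bracket L x y = \<zero>\<^bsub>L\<^esub>}
      = Sigma (carrier L) centralizer" by auto
  then have deg: "commutativity_degree L = (\<Sum>x\<in>carrier L. real (card (centralizer x))) / ?N\<^sup>2"
    using fin by (simp add: commutativity_degree_def)
  have orb: "real (card (centralizer x)) * real (card (bracket L x ` carrier L)) = ?N"
    if "x \<in> carrier L" for x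
    using card_centralizer_times_card_ad_image[OF fin that, THEN arg_cong, of real] by simp
  have lower: "?N / r \<le> real (card (centralizer x))" if x: "x \<in> carrier L" for x
  proof -
    have "?N = real (card (centralizer x)) * real (card (bracket L x ` carrier L))"
      by (rule orb[OF x, symmetric])
    also have "\<dots> \<le> real (card (centralizer x)) * real r"
      using le[OF x] by (intro mult_left_mono) simp_all
    finally show ?thesis using r by (simp add: divide_le_eq)
  qed
  have "?N * (?N / r) \<le> (\<Sum>x\<in>carrier L. real (card (centralizer x)))"
    using sum_mono[of "carrier L" "\<lambda>_. ?N / r", OF lower] by simp
  from divide_right_mono[OF this, of "?N\<^sup>2"] show "1 / real r \<le> commutativity_degree L"
    using N by (simp add: deg power2_eq_square)
  have "real (card (centralizer x)) \<le> ?N / r + (if x \<in> B then ?N else 0)"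
    if x: "x \<in> carrier L" for x
  proof (cases "x \<in> B")
    case True
    have "card (centralizer x) \<le> card (carrier L)"
      using fin by (intro card_mono) auto
    then have "real (card (centralizer x)) \<le> ?N / r + ?N"
      by (intro add_increasing) simp_all
    then show ?thesis using True by simp
  next
    case False
    then have "real (card (centralizer x)) * real r = ?N"
      using orb[OF x] eq[of x] x by simp
    then have "real (card (centralizer x)) = ?N / r"
      using r by (simp add: eq_divide_eq)
    then show ?thesis using False by simp
  qed
  then have "(\<Sum>x\<in>carrier L. real (card (centralizer x)))
      \<le> (\<Sum>x\<in>carrier L. ?N / r + (if x \<in> B then ?N else 0))"
    by (rule sum_mono)
  also have "\<dots> = ?N * (?N / r) + card B * ?N"
    using fin B by (simp add: sum.distrib sum.If_cases Int_absorb1)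
  finally have "commutativity_degree L \<le> (?N * (?N / r) + card B * ?N) / ?N\<^sup>2"
    unfolding deg by (rule divide_right_mono) simp
  also have "\<dots> = 1 / real r + real (card B) / ?N"
    using N by (simp add: add_divide_distrib power2_eq_square)
  finally show "commutativity_degree L \<le> 1 / real r + real (card B) / ?N" .
qed

end

lemma (in vectorspace) finite_carrier_imp_fin_dim:
  assumes "finite (carrier V)"
  shows "fin_dim"
  unfolding fin_dim_def
  using assms in_own_span[of "carrier V"] span_is_subset2[of "carrier V"] by blast

section \<open>The evaluation Lie algebra\<close>

text \<open>
  An element of \<open>K^m \<oplus> Hom(K^m, K^n) \<oplus> K^n\<close> is stored as one function on the indices below
  \<open>n + m + n * m\<close>: the part in \<open>K^n\<close> comes first, then the vector \<open>v\<close> in \<open>K^m\<close>, then the \<open>n\<close> rows,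
  each of length \<open>m\<close>, of the matrix \<open>\<phi>\<close>. With \<open>v\<close> the vector of \<open>f\<close> and \<open>\<psi>\<close> the matrix of
  \<open>g\<close>, the following sum is the \<open>k\<close>-th coordinate of \<open>\<psi>(v)\<close>.
\<close>

definition (in ring) eval_form :: "nat \<Rightarrow> nat \<Rightarrow> nat \<Rightarrow> (nat \<Rightarrow> 'a) \<Rightarrow> (nat \<Rightarrow> 'a) \<Rightarrow> 'a" where
  "eval_form n m k f g = (\<Oplus>j\<in>{..<m}. f (n + j) \<otimes> g (n + m + k * m + j))"

definition (in ring) eval_lie_algebra :: "nat \<Rightarrow> nat \<Rightarrow> ('a, nat \<Rightarrow> 'a) lie_algebra" where
  "eval_lie_algebra n m = module.extend (func_space {..<n + m + n * m})
     (lie_algebra.fields (\<lambda>f g. restrict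
        (\<lambda>k. if k < n then eval_form n m k f g \<ominus> eval_form n m k g f else \<zero>)
        {..<n + m + n * m}))"

context field
begin

context
  fixes n m :: nat
begin

abbreviation "dim_L \<equiv> n + m + n * m"
abbreviation "L \<equiv> eval_lie_algebra n m"
abbreviation "form \<equiv> eval_form n m"

lemma eval_lie_algebra_simps:
  "carrier L = {..<dim_L} \<rightarrow>\<^sub>E carrier R"
  "\<zero>\<^bsub>L\<^esub> = restrict (\<lambda>_. \<zero>) {..<dim_L}"
  "f \<oplus>\<^bsub>L\<^esub> g = restrict (\<lambda>k. f k \<oplus> g k) {..<dim_L}"
  "c \<odot>\<^bsub>L\<^esub> f = restrict (\<lambda>k. c \<otimes> f k) {..<dim_L}"
  "bracket L f g = restrict (\<lambda>k. if k < n then form k f g \<ominus> form k g f else \<zero>) {..<dim_L}"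
  by (simp_all add: eval_lie_algebra_def func_space_def module.defs lie_algebra.defs)

lemma index_bound:
  assumes "k < n" "j < m"
  shows "n + m + k * m + j < dim_L" "n + j < dim_L"
proof -
  have "(k + 1) * m \<le> n * m"
    using assms by (intro mult_right_mono) auto
  then show "n + m + k * m + j < dim_L" using assms by simp
  show "n + j < dim_L" using assms by simp
qed

lemma L_coord [simp]: "f \<in> carrier L \<Longrightarrow> i < dim_L \<Longrightarrow> f i \<in> carrier R"
  by (auto simp: eval_lie_algebra_simps)

lemma form_closed [simp]:
  assumes "f \<in> carrier L" "g \<in> carrier L" "k < n"
  shows "form k f g \<in> carrier R"
  unfolding eval_form_def using assms index_bound
  by (auto intro!: finsum_closed m_closed L_coord)

lemma form_cong:
  assumes "\<And>j. j < m \<Longrightarrow> f (n + j) \<otimes> g (n + m + k * m + j) = c j"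
      "\<And>j. j < m \<Longrightarrow> c j \<in> carrier R"
  shows "form k f g = finsum R c {..<m}"
  unfolding eval_form_def using assms
  by (intro finsum_cong') auto

text \<open>
  The underlying module is the function space; the extra field for the bracket changes the record
  type, so the module laws have to be carried over one by one.
\<close>

lemma eval_vectorspace: "vectorspace R L"
proof -
  let ?F = "func_space {..<dim_L} :: ('a, nat \<Rightarrow> 'a) module"
  interpret F: module R ?F
    by (rule func_space_is_module)
  have eqs: "carrier L = carrier ?F" "\<zero>\<^bsub>L\<^esub> = \<zero>\<^bsub>?F\<^esub>"
      "\<And>f g. f \<oplus>\<^bsub>L\<^esub> g = f \<oplus>\<^bsub>?F\<^esub> g" "\<And>c f. c \<odot>\<^bsub>L\<^esub> f = c \<odot>\<^bsub>?F\<^esub> f"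
    by (simp_all add: eval_lie_algebra_simps func_space_def)
  have "module R L"
    by (rule module_criteria)
      (auto simp: eqs F.smult_assoc1 F.smult_l_distr F.smult_r_distr cring_axioms
        F.a_ac intro: bexI[of _ "\<ominus>\<^bsub>?F\<^esub> _"] F.r_neg)
  then show ?thesis
    by (simp add: vectorspace_def field_axioms)
qed

lemma form_add_left:
  assumes "f \<in> carrier L" "g \<in> carrier L" "h \<in> carrier L" "k < n"
  shows "form k (f \<oplus>\<^bsub>L\<^esub> g) h = form k f h \<oplus> form k g h"
proof -
  have "form k (f \<oplus>\<^bsub>L\<^esub> g) h = (\<Oplus>j\<in>{..<m}. f (n + j) \<otimes> h (n + m + k * m + j)
      \<oplus> g (n + j) \<otimes> h (n + m + k * m + j))"
    using assms index_bound[OF assms(4)]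
    by (intro form_cong) (simp_all add: eval_lie_algebra_simps(3) l_distr)
  also have "\<dots> = form k f h \<oplus> form k g h"
    unfolding eval_form_def using assms index_bound[OF assms(4)]
    by (intro finsum_addf) auto
  finally show ?thesis .
qed

lemma form_add_right:
  assumes "f \<in> carrier L" "g \<in> carrier L" "h \<in> carrier L" "k < n"
  shows "form k f (g \<oplus>\<^bsub>L\<^esub> h) = form k f g \<oplus> form k f h"
proof -
  have "form k f (g \<oplus>\<^bsub>L\<^esub> h) = (\<Oplus>j\<in>{..<m}. f (n + j) \<otimes> g (n + m + k * m + j)
      \<oplus> f (n + j) \<otimes> h (n + m + k * m + j))"
    using assms index_bound[OF assms(4)]
    by (intro form_cong) (simp_all add: eval_lie_algebra_simps(3) r_distr)
  also have "\<dots> = form k f g \<oplus> form k f h"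
    unfolding eval_form_def using assms index_bound[OF assms(4)]
    by (intro finsum_addf) auto
  finally show ?thesis .
qed

lemma form_smult_left:
  assumes "c \<in> carrier R" "f \<in> carrier L" "g \<in> carrier L" "k < n"
  shows "form k (c \<odot>\<^bsub>L\<^esub> f) g = c \<otimes> form k f g"
proof -
  have "form k (c \<odot>\<^bsub>L\<^esub> f) g = (\<Oplus>j\<in>{..<m}. c \<otimes> (f (n + j) \<otimes> g (n + m + k * m + j)))"
    using assms index_bound[OF assms(4)]
    by (intro form_cong) (simp_all add: eval_lie_algebra_simps(4) m_assoc)
  also have "\<dots> = c \<otimes> form k f g"
    unfolding eval_form_def using assms index_bound[OF assms(4)]
    by (intro finsum_rdistr[symmetric]) auto
  finally show ?thesis .
qed

lemma form_smult_right:
  assumes "c \<in> carrier R" "f \<in> carrier L" "g \<in> carrier L" "k < n"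
  shows "form k f (c \<odot>\<^bsub>L\<^esub> g) = c \<otimes> form k f g"
proof -
  have "form k f (c \<odot>\<^bsub>L\<^esub> g) = (\<Oplus>j\<in>{..<m}. c \<otimes> (f (n + j) \<otimes> g (n + m + k * m + j)))"
    using assms index_bound[OF assms(4)]
    by (intro form_cong) (simp_all add: eval_lie_algebra_simps(4) m_lcomm)
  also have "\<dots> = c \<otimes> form k f g"
    unfolding eval_form_def using assms index_bound[OF assms(4)]
    by (intro finsum_rdistr[symmetric]) auto
  finally show ?thesis .
qed

lemma bracket_in_carrier:
  assumes "f \<in> carrier L" "g \<in> carrier L"
  shows "bracket L f g \<in> carrier L"
proof -
  have "(if k < n then form k f g \<ominus> form k g f else \<zero>) \<in> carrier R" for k
    using assms by simp
  then show ?thesis by (simp add: eval_lie_algebra_simps(1,5))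
qed

text \<open>
  Evaluation involves only the vector and the matrix; an element for which both vanish is central.
\<close>

lemma bracket_central:
  assumes f: "f \<in> carrier L" and g: "g \<in> carrier L"
    and z: "\<And>k. n \<le> k \<Longrightarrow> k < dim_L \<Longrightarrow> g k = \<zero>"
  shows "bracket L f g = \<zero>\<^bsub>L\<^esub>"
proof -
  have "form k f g = \<zero>" "form k g f = \<zero>" if k: "k < n" for k
  proof -
    have "form k f g = (\<Oplus>j\<in>{..<m}. \<zero>)" "form k g f = (\<Oplus>j\<in>{..<m}. \<zero>)"
      using f g index_bound[OF k]
      by (intro form_cong; simp add: z)+
    then show "form k f g = \<zero>" "form k g f = \<zero>" by simp_all
  qed
  then show ?thesis
    by (auto simp: eval_lie_algebra_simps(2,5) minus_eq)
qed

lemma bracket_coord_eq_zero: "n \<le> k \<Longrightarrow> k < dim_L \<Longrightarrow> bracket L f g k = \<zero>"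
  by (simp add: eval_lie_algebra_simps(5))

lemma minus_add_minus:
  assumes "a \<in> carrier R" "b \<in> carrier R" "c \<in> carrier R" "d \<in> carrier R"
  shows "(a \<oplus> b) \<ominus> (c \<oplus> d) = (a \<ominus> c) \<oplus> (b \<ominus> d)"
  using assms by (simp add: minus_eq minus_add a_ac)

lemma mult_minus_distr:
  assumes "a \<in> carrier R" "b \<in> carrier R" "c \<in> carrier R"
  shows "a \<otimes> b \<ominus> a \<otimes> c = a \<otimes> (b \<ominus> c)"
  using assms by (simp add: minus_eq r_distr r_minus)

lemma eval_lie_algebra_is_lie_algebra: "lie_algebra R L"
proof -
  interpret V: vectorspace R L by (rule eval_vectorspace)
  show ?thesis
  proof (unfold_locales, goal_cases)
    case (1 x y)
    then show ?case by (rule bracket_in_carrier)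
  next
    case (2 x y z)
    have "form k (x \<oplus>\<^bsub>L\<^esub> y) z \<ominus> form k z (x \<oplus>\<^bsub>L\<^esub> y)
        = (form k x z \<ominus> form k z x) \<oplus> (form k y z \<ominus> form k z y)" if "k < n" for k
      using 2 that by (simp add: form_add_left form_add_right minus_add_minus)
    then show ?case
      unfolding eval_lie_algebra_simps(5) eval_lie_algebra_simps(3)[of "restrict _ _"]
      by (intro restrict_ext) simp
  next
    case (3 x y z)
    have "form k x (y \<oplus>\<^bsub>L\<^esub> z) \<ominus> form k (y \<oplus>\<^bsub>L\<^esub> z) x
        = (form k x y \<ominus> form k y x) \<oplus> (form k x z \<ominus> form k z x)" if "k < n" for k
      using 3 that by (simp add: form_add_left form_add_right minus_add_minus)
    then show ?case
      unfolding eval_lie_algebra_simps(5) eval_lie_algebra_simps(3)[of "restrict _ _"]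
      by (intro restrict_ext) simp
  next
    case (4 a x y)
    have "form k (a \<odot>\<^bsub>L\<^esub> x) y \<ominus> form k y (a \<odot>\<^bsub>L\<^esub> x)
        = a \<otimes> (form k x y \<ominus> form k y x)" if "k < n" for k
      using 4 that by (simp add: form_smult_left form_smult_right mult_minus_distr)
    then show ?case using 4
      unfolding eval_lie_algebra_simps(5) eval_lie_algebra_simps(4)[of _ "restrict _ _"]
      by (intro restrict_ext) simp
  next
    case (5 a x y)
    have "form k x (a \<odot>\<^bsub>L\<^esub> y) \<ominus> form k (a \<odot>\<^bsub>L\<^esub> y) x
        = a \<otimes> (form k x y \<ominus> form k y x)" if "k < n" for k
      using 5 that by (simp add: form_smult_left form_smult_right mult_minus_distr)
    then show ?case using 5
      unfolding eval_lie_algebra_simps(5) eval_lie_algebra_simps(4)[of _ "restrict _ _"]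
      by (intro restrict_ext) simp
  next
    case (6 x)
    then show ?case
      by (auto simp: eval_lie_algebra_simps(2,5) r_neg minus_eq intro!: restrict_ext)
  next
    case (7 x y z)
    (* Every bracket is central, so all three double brackets are zero. *)
    then show ?case
      by (simp add: bracket_central bracket_in_carrier bracket_coord_eq_zero)
  qed
qed

lemma card_eval_lie_algebra: "card (carrier L) = card (carrier R) ^ dim_L"
  by (simp add: eval_lie_algebra_simps(1) card_PiE)

abbreviation central_block :: "(nat \<Rightarrow> 'a) set" where
  "central_block \<equiv> (\<Pi>\<^sub>E k\<in>{..<dim_L}. if k < n then carrier R else {\<zero>})"

lemma card_central_block: "card central_block = card (carrier R) ^ n"
proof -
  have "card central_block = (\<Prod>k<dim_L. if k < n then card (carrier R) else 1)"
    by (subst card_PiE) (auto intro!: prod.cong)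
  also have "\<dots> = (\<Prod>k<n. card (carrier R))"
    by (rule prod.mono_neutral_cong_right) auto
  finally show ?thesis by simp
qed

abbreviation zero_vector_block :: "(nat \<Rightarrow> 'a) set" where
  "zero_vector_block \<equiv> {f \<in> carrier L. \<forall>j<m. f (n + j) = \<zero>}"

lemma card_zero_vector_block:
  "card (carrier L) = card zero_vector_block * card (carrier R) ^ m"
proof -
  have "zero_vector_block
      = (\<Pi>\<^sub>E k\<in>{..<dim_L}. if k \<in> {n..<n + m} then {\<zero>} else carrier R)" (is "_ = ?Z")
  proof (rule equalityI; rule subsetI)
    fix f assume f: "f \<in> zero_vector_block"
    have "f k = \<zero>" if "k \<in> {n..<n + m}" for k
    proof -
      have "k - n < m" "n + (k - n) = k" using that by auto
      moreover have "\<forall>j<m. f (n + j) = \<zero>" using f by blast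
      ultimately show ?thesis by metis
    qed
    then show "f \<in> ?Z" using f by (simp add: eval_lie_algebra_simps(1) PiE_iff)
  next
    fix f assume f: "f \<in> ?Z"
    have "f k \<in> carrier R" if "k < dim_L" for k
      using PiE_mem[OF f, of k] that by (simp split: if_splits)
    moreover have "f (n + j) = \<zero>" if "j < m" for j
      using PiE_mem[OF f, of "n + j"] that by simp
    ultimately show "f \<in> zero_vector_block"
      using f by (simp add: eval_lie_algebra_simps(1) PiE_iff)
  qed
  then have "card zero_vector_block
      = (\<Prod>k<dim_L. if k \<in> {n..<n + m} then 1 else card (carrier R))"
    by (simp add: card_PiE if_distrib cong: if_cong)
  also have "\<dots> = (\<Prod>k\<in>{..<dim_L} - {n..<n + m}. card (carrier R))"
    by (rule prod.mono_neutral_cong_right) auto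
  also have "\<dots> = card (carrier R) ^ (n + n * m)"
    by (subst prod_constant, subst card_Diff_subset) auto
  finally show ?thesis
    by (simp add: card_eval_lie_algebra power_add[symmetric] algebra_simps)
qed

lemma ad_image_subset:
  assumes "f \<in> carrier L"
  shows "bracket L f ` carrier L \<subseteq> central_block"
proof (rule image_subsetI, rule PiE_I)
  fix g k assume g: "g \<in> carrier L"
  show "bracket L f g k \<in> (if k < n then carrier R else {\<zero>})" if "k \<in> {..<dim_L}"
    using that L_coord[OF bracket_in_carrier[OF assms g], of k] bracket_coord_eq_zero[of k f g]
    by auto
  show "bracket L f g k = undefined" if "k \<notin> {..<dim_L}"
    using that by (simp add: eval_lie_algebra_simps(5))
qed

text \<open>
  A linear map can send a nonzero vector \<open>v\<close> to any prescribed \<open>z\<close>. If \<open>v\<close> has nonzero \<open>i\<close>-th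
  coordinate, take the matrix whose \<open>i\<close>-th column is \<open>z\<close> divided by that coordinate and whose other
  columns vanish. The preimage \<open>g\<close> of \<open>z\<close> under \<open>[f, -]\<close> consists of this matrix alone.
\<close>

lemma ad_image_eq:
  assumes f: "f \<in> carrier L - zero_vector_block"
  shows "bracket L f ` carrier L = central_block"
proof (rule antisym)
  show "bracket L f ` carrier L \<subseteq> central_block"
    using f by (intro ad_image_subset) simp
  show "central_block \<subseteq> bracket L f ` carrier L"
  proof
    fix z assume z: "z \<in> central_block"
    from f obtain i where i: "i < m" "f (n + i) \<noteq> \<zero>" by auto
    let ?a = "inv (f (n + i))"
    have fi: "f (n + i) \<in> carrier R" using f i by simp
    then have a: "?a \<in> carrier R" "f (n + i) \<otimes> ?a = \<one>"
      using i(2) by (auto simp: field_Units)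
    (* Index n + m + k * m + j is row k, column j: quotient and remainder modulo m recover both. *)
    define g where "g = restrict
      (\<lambda>k. if n + m \<le> k \<and> (k - (n + m)) mod m = i then ?a \<otimes> z ((k - (n + m)) div m) else \<zero>) {..<dim_L}"
    have zR: "z k \<in> carrier R" if "k < n" for k
      using PiE_mem[OF z, of k] that by simp
    have block: "(k - (n + m)) div m < n" if "n + m \<le> k" "k < dim_L" for k
      using that i by (subst div_less_iff_less_mult) auto
    have g: "g \<in> carrier L"
      using a zR block by (auto simp: g_def eval_lie_algebra_simps(1))
    have "bracket L f g = z"
    proof
      fix k
      consider "k < n" | "n \<le> k" "k < dim_L" | "dim_L \<le> k" by linarith
      then show "bracket L f g k = z k"
      proof cases
        case 1
        have gk: "g (n + m + k * m + j) = (if j = i then ?a \<otimes> z k else \<zero>)"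
          if j: "j < m" for j
        proof -
          have "n + m + k * m + j - (n + m) = j + k * m" by simp
          then have "(n + m + k * m + j - (n + m)) mod m = j"
              "(n + m + k * m + j - (n + m)) div m = k"
            using j by simp_all
          then show ?thesis
            using index_bound(1)[OF 1 j] by (auto simp: g_def)
        qed
        have "form k f g = (\<Oplus>j\<in>{..<m}. if i = j then z k else \<zero>)"
          using gk a zR[OF 1] f fi index_bound(2)[OF 1]
          by (intro form_cong) (auto simp: m_assoc[symmetric])
        also have "\<dots> = z k"
          using i zR[OF 1] by (intro finsum_singleton) auto
        finally have fg: "form k f g = z k" .
        have "form k g f = (\<Oplus>j\<in>{..<m}. \<zero>)"
          using f index_bound[OF 1]
          by (intro form_cong) (auto simp: g_def)
        then have "form k g f = \<zero>" by simp
        with fg show ?thesis using 1 zR[OF 1]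
          by (simp add: eval_lie_algebra_simps(5) minus_eq)
      next
        case 2
        then show ?thesis using z bracket_coord_eq_zero by (force simp: PiE_iff)
      next
        case 3
        then show ?thesis using z
          by (auto simp: eval_lie_algebra_simps(5) PiE_iff extensional_def)
      qed
    qed
    with g show "z \<in> bracket L f ` carrier L" by blast
  qed
qed

end
end

section \<open>The asymptotic commutativity degree\<close>

theorem theorem3p4:
  fixes F :: "('a, 'b) ring_scheme" and q n :: nat
  assumes "primepow q"
    and "field F" and "finite (carrier F)" and "card (carrier F) = q"
    and "n \<ge> 1"
  shows "\<exists>L :: nat \<Rightarrow> ('a, nat \<Rightarrow> 'a) lie_algebra.
           (\<forall>m\<ge>1. lie_algebra F (L m) \<and> vectorspace.fin_dim F (L m) \<and> \<not> abelian_lie (L m)) \<and>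
           has_asymptotic_commutativity_degree L (1 / real q ^ n)"
proof -
  interpret field F by fact
  let ?L = "eval_lie_algebra n :: nat \<Rightarrow> ('a, nat \<Rightarrow> 'a) lie_algebra"
  have q: "q > 1" using primepow_gt_Suc_0[OF assms(1)] by simp
  have lie: "lie_algebra F (?L m)" for m
    by (rule eval_lie_algebra_is_lie_algebra)
  have fin: "finite (carrier (?L m))" for m
    using assms(3) by (simp add: eval_lie_algebra_simps(1) finite_PiE)
  have card_L: "card (carrier (?L m)) = q ^ (n + m + n * m)" for m
    using card_eval_lie_algebra[of n m] assms(4) by simp
  have card_block: "card (carrier (?L m)) = card (zero_vector_block n m) * q ^ m" for m
    using card_zero_vector_block[of n m] assms(4) by simp
  have rank: "card (bracket (?L m) f ` carrier (?L m)) = q ^ n"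
    if "f \<in> carrier (?L m) - zero_vector_block n m" for f m
    using that ad_image_eq[of f n m] card_central_block[of n m] assms(4) by simp
  have rank_le: "card (bracket (?L m) f ` carrier (?L m)) \<le> q ^ n"
    if "f \<in> carrier (?L m)" for f m
  proof -
    have "finite (central_block n m)"
      using assms(3) by (intro finite_PiE) auto
    from card_mono[OF this ad_image_subset[OF that]] show ?thesis
      using card_central_block[of n m] assms(4) by simp
  qed
  have nonabelian: "\<not> abelian_lie (?L m)" if m: "m \<ge> 1" for m
  proof
    assume ab: "abelian_lie (?L m)"
    have "zero_vector_block n m \<noteq> carrier (?L m)"
    proof
      assume "zero_vector_block n m = carrier (?L m)"
      then have "card (carrier (?L m)) = card (carrier (?L m)) * q ^ m"
        using card_block[of m] by simp
      then have "q ^ m = 1" using card_L[of m] q by simp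
      then show False using q m by simp
    qed
    then obtain f where f: "f \<in> carrier (?L m) - zero_vector_block n m" by blast
    have "bracket (?L m) f ` carrier (?L m) \<subseteq> {\<zero>\<^bsub>?L m\<^esub>}"
      using ab f by (auto simp: abelian_lie_def)
    from card_mono[OF _ this] have "q ^ n \<le> 1"
      unfolding rank[OF f] by simp
    then show False using one_less_power[of q n] q assms(5) by simp
  qed
  have bounds: "1 / real q ^ n \<le> commutativity_degree (?L m)"
    "commutativity_degree (?L m) \<le> 1 / real q ^ n + (1 / real q) ^ m" for m
  proof -
    have "q ^ n > 0" using q by simp
    note deg = lie_algebra.commutativity_degree_bounds[OF lie[of m] fin this, of "zero_vector_block n m",
        OF _ rank_le rank]
    have "card (carrier (?L m)) \<noteq> 0" using q by (simp add: card_L)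
    then have "card (zero_vector_block n m) \<noteq> 0"
      unfolding card_block[of m] by (rule contrapos_nn) simp
    then have "real (card (zero_vector_block n m)) / real (card (carrier (?L m))) = (1 / real q) ^ m"
      unfolding card_block[of m] using q by (simp add: power_one_over field_simps)
    then show "1 / real q ^ n \<le> commutativity_degree (?L m)"
      "commutativity_degree (?L m) \<le> 1 / real q ^ n + (1 / real q) ^ m"
      using deg by auto
  qed
  have "(\<lambda>m. (1 / real q) ^ m) \<longlonglongrightarrow> 0"
    using q by (intro LIMSEQ_realpow_zero) auto
  then have upper: "(\<lambda>m. 1 / real q ^ n + (1 / real q) ^ m) \<longlonglongrightarrow> 1 / real q ^ n"
    using tendsto_add[OF tendsto_const, of _ 0 _ "1 / real q ^ n"] by simp
  have "(\<lambda>m. commutativity_degree (?L m)) \<longlonglongrightarrow> 1 / real q ^ n"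
    by (rule tendsto_sandwich[OF _ _ tendsto_const upper]) (simp_all add: bounds)
  moreover have "filterlim (\<lambda>m. card (carrier (?L m))) at_top sequentially"
  proof (rule filterlim_at_top_mono[OF filterlim_ident])
    have "m \<le> card (carrier (?L m))" for m
    proof -
      have "m < q ^ m" using q by (intro power_gt_expt) simp
      also have "q ^ m \<le> q ^ (n + m + n * m)"
        using q by (intro power_increasing) auto
      finally show ?thesis by (simp add: card_L)
    qed
    then show "\<forall>\<^sub>F m in sequentially. m \<le> card (carrier (?L m))" by simp
  qed
  ultimately have "has_asymptotic_commutativity_degree ?L (1 / real q ^ n)"
    by (simp add: has_asymptotic_commutativity_degree_def)
  moreover have "vectorspace.fin_dim F (?L m)" for m
    using eval_vectorspace fin by (rule vectorspace.finite_carrier_imp_fin_dim)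
  ultimately show ?thesis
    using lie nonabelian by blast
qed

end
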